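(* Let $k \ge 3$ and $d \in \mathbb{N}$. Then, as formal power series, \[ C_d^{(k)}(y) = y^d\,\bigl(H_{k-1}(y)\bigr)^{\lfloor d/k\rfloor+1}. \]
   Context: Words are over the alphabet $\mathbb{N}=\{0,1,2,\dots\}$ (letters called digits). For $k\ge 2$, $\phi_k:\mathbb{N}^*\to\mathbb{N}^*$ is the morphism defined for $i\in\mathbb{N}$, $0\le j\le k-1$ by $\phi_k(ki+j)=(ki)(ki+j+1)$ if $0\le j\le k-2$ and $\phi_k(ki+k-1)=ki+k$. Set $W_n^{(k)}=\phi_k^n(0)$. For a digit $d$, $c^{(k)}(d;n)$ is the number of occurrences of $d$ in $W_n^{(k)}$ and $C_d^{(k)}(y)=\sum_{n\ge0}c^{(k)}(d;n)y^n$. $H_{k-1}(y)=1/(1-y-y^2-\cdots-y^{k-1})$ as a formal power series. *)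

theory Defs
  imports Complex_Main "HOL-Computational_Algebra.Formal_Power_Series"
begin

text \<open>
  Words over \<open>\<nat>\<close> are lists of natural numbers. A digit \<open>d\<close> is written uniquely as
  \<open>k * i + j\<close> with \<open>i = d div k\<close> and \<open>j = d mod k\<close>; the construction is meant for \<open>k \<ge> 2\<close>.
\<close>

definition phi_digit :: "nat \<Rightarrow> nat \<Rightarrow> nat list" where
  "phi_digit k d =
    (let i = d div k; j = d mod k
     in if j \<le> k - 2 then [k * i, k * i + j + 1] else [k * i + k])"

definition phi :: "nat \<Rightarrow> nat list \<Rightarrow> nat list" where
  "phi k w = concat (map (phi_digit k) w)"

lemma phi_append: "phi k (u @ v) = phi k u @ phi k v"
  by (simp add: phi_def)

lemma phi_low:
  assumes "k \<ge> 2" and "j \<le> k - 2"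
  shows "phi k [k * i + j] = [k * i, k * i + j + 1]"
  using assms by (simp add: phi_def phi_digit_def)

lemma phi_top:
  assumes "k \<ge> 2"
  shows "phi k [k * i + k - 1] = [k * i + k]"
proof -
  obtain m where k: "k = Suc m" and m: "m > 0"
    using assms by (cases k) auto
  have "k * i + k - 1 = k * i + m" using k by simp
  moreover have "(k * i + m) div k = i" "(k * i + m) mod k = m"
    using k by (simp_all add: div_mult_self4 del: mult_Suc)
  ultimately show ?thesis using k m by (simp add: phi_def phi_digit_def del: mult_Suc)
qed

definition W :: "nat \<Rightarrow> nat \<Rightarrow> nat list" where
  "W k n = (phi k ^^ n) [0]"

definition digit_count :: "nat \<Rightarrow> nat \<Rightarrow> nat \<Rightarrow> nat" where
  "digit_count k d n = count_list (W k n) d"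

text \<open>The generating functions have integer coefficients; they are taken over the rationals,
  where the library provides division of formal power series.\<close>

definition C :: "nat \<Rightarrow> nat \<Rightarrow> rat fps" where
  "C k d = Abs_fps (\<lambda>n. of_nat (digit_count k d n))"

definition H :: "nat \<Rightarrow> rat fps" where
  "H m = 1 / (1 - (\<Sum>j=1..m. fps_X ^ j))"

end

theory Submission
  imports Defs
begin

text \<open>
  A digit \<open>d\<close> not divisible by \<open>k\<close> arises under \<open>\<phi>\<^sub>k\<close> only from \<open>d - 1\<close>, so \<open>C\<^sub>d = y C\<^sub>d\<^sub>-\<^sub>1\<close>.
  A digit \<open>k i\<close> arises from \<open>k i, \<dots>, k i + k - 2\<close> and, if \<open>i > 0\<close>, from \<open>k i - 1\<close>; substituting
  the first relation gives \<open>(1 - y - \<dots> - y\<^sup>k\<^sup>-\<^sup>1) C\<^sub>k\<^sub>i = y C\<^sub>k\<^sub>i\<^sub>-\<^sub>1\<close> (or \<open>= 1\<close> for \<open>i = 0\<close>), and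
  induction on \<open>d\<close> concludes.
\<close>

text \<open>Apart from the second letter \<open>a + 1\<close> in the image of a non-top digit
  \<open>a\<close>, every letter that \<open>phi_digit\<close> produces is a multiple of
  \<open>k\<close>.\<close>

lemma count_phi_digit_Suc:
  assumes "k \<ge> 2" "Suc d mod k \<noteq> 0"
  shows "count_list (phi_digit k a) (Suc d) = of_bool (a = d)"
proof -
  have "k * (a div k) \<noteq> Suc d" "k * (a div k) + k \<noteq> Suc d"
    using assms(2) by (metis mod_mult_self1_is_0 mod_add_self2 mult.commute)+
  moreover have "a \<noteq> d" if "\<not> a mod k \<le> k - 2"
  proof
    assume "a = d"
    have "a mod k < k" using assms(1) by simp
    with that have "Suc (a mod k) = k" by linarith
    then have "Suc a mod k = 0" by (simp add: mod_Suc)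
    with \<open>a = d\<close> assms(2) show False by simp
  qed
  ultimately show ?thesis
    by (auto simp: phi_digit_def Let_def)
qed

text \<open>The sum records the first letters of the images of the non-top digits in block
  \<open>i\<close>; the last term records the top digit of the preceding block. Writing it with
  \<open>Suc a\<close> makes it vanish for \<open>i = 0\<close> without truncated
  subtraction.\<close>

lemma count_phi_digit_mult:
  assumes "k \<ge> 2"
  shows "count_list (phi_digit k a) (k * i)
    = (\<Sum>j<k - 1. of_bool (a = k * i + j)) + of_bool (Suc a = k * i)"
proof -
  have lt: "a mod k < k" using assms by simp
  have a: "k * (a div k) + a mod k = a" by simp
  have div_eq: "a div k = i" if "a = k * i + j" "j < k" for j
    using that by simp
  \<comment> \<open>At most one summand is nonzero, namely the one with
    \<open>j = a mod k\<close>.\<close>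
  have sum: "(\<Sum>j<k - 1. of_bool (a = k * i + j)) = (of_bool (a div k = i \<and> a mod k < k - 1) :: nat)"
  proof (cases "a div k = i")
    case True
    then have "k * i + a mod k = a" by auto
    then have "a = k * i + j \<longleftrightarrow> a mod k = j" for j by linarith
    then show ?thesis using True by (simp add: of_bool_def sum.delta')
  next
    case False
    then have "a \<noteq> k * i + j" if "j < k - 1" for j using that div_eq by force
    then show ?thesis using False by simp
  qed
  show ?thesis
  proof (cases "a mod k \<le> k - 2")
    case True
    then have "Suc a mod k = Suc (a mod k)" using assms by (simp add: mod_Suc)
    then have "Suc a \<noteq> k * i" by auto
    moreover have "k * (a div k) + a mod k + 1 \<noteq> k * i"
      using \<open>Suc a \<noteq> k * i\<close> a by simp
    ultimately show ?thesis
      unfolding sum using True assms by (auto simp: phi_digit_def Let_def)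
  next
    case False
    then have r: "Suc (a mod k) = k" using lt by linarith
    then have "Suc a = k * (a div k) + k" using a by linarith
    then show ?thesis
      unfolding sum using False r by (auto simp: phi_digit_def Let_def)
  qed
qed

lemma count_phi_Suc:
  assumes "k \<ge> 2" "Suc d mod k \<noteq> 0"
  shows "count_list (phi k w) (Suc d) = count_list w d"
  by (induction w) (auto simp: phi_def count_phi_digit_Suc[OF assms])

lemma count_phi_mult:
  assumes "k \<ge> 2"
  shows "count_list (phi k w) (k * i) = (\<Sum>j<k - 1. count_list w (k * i + j))
    + (if i = 0 then 0 else count_list w (k * i - 1))"
proof (induction w)
  case Nil
  then show ?case by (simp add: phi_def)
next
  case (Cons a w)
  have count_Cons: "count_list (a # w) x = of_bool (a = x) + count_list w x" for x
    by simp
  have "of_bool (Suc a = k * i) = (if i = 0 then 0 else of_bool (a = k * i - 1) :: nat)"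
    using assms by auto
  moreover have "phi k (a # w) = phi_digit k a @ phi k w"
    by (simp add: phi_def)
  ultimately show ?case
    using Cons count_phi_digit_mult[OF assms, of a i]
    by (simp add: count_Cons sum.distrib del: count_list.simps)
qed

lemma C_Suc:
  assumes "k \<ge> 2" "Suc d mod k \<noteq> 0"
  shows "C k (Suc d) = fps_X * C k d"
proof (rule fps_ext)
  fix n
  show "fps_nth (C k (Suc d)) n = fps_nth (fps_X * C k d) n"
    by (cases n) (simp_all add: C_def digit_count_def W_def count_phi_Suc[OF assms])
qed

lemma C_add:
  assumes "k \<ge> 2" "j < k"
  shows "C k (k * i + j) = fps_X ^ j * C k (k * i)"
  using assms(2)
proof (induction j)
  case (Suc j)
  then show ?case
    using C_Suc[of k "k * i + j"] assms(1) by (simp add: mult.assoc flip: add_Suc_right)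
qed simp

text \<open>Positive powers of \<open>fps_X\<close> follow from the count recurrence. The constant
  term comes from the initial word \<open>[0]\<close>, hence the \<open>1\<close> exactly when
  \<open>i = 0\<close>.\<close>

lemma C_mult:
  assumes "k \<ge> 2"
  shows "C k (k * i) = fps_X * (\<Sum>j<k - 1. C k (k * i + j))
    + (if i = 0 then 1 else fps_X * C k (k * i - 1))"
proof (rule fps_ext)
  fix n
  show "fps_nth (C k (k * i)) n = fps_nth (fps_X * (\<Sum>j<k - 1. C k (k * i + j))
    + (if i = 0 then 1 else fps_X * C k (k * i - 1))) n"
    using assms count_phi_mult[OF assms, of _ i]
    by (cases n) (auto simp: C_def digit_count_def W_def fps_sum_nth)
qed

lemma H_unfold: "H m * (1 - (\<Sum>j=1..m. fps_X ^ j)) = 1"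
proof -
  let ?f = "1 - (\<Sum>j=1..m. fps_X ^ j) :: rat fps"
  \<comment> \<open>The sum starts at \<open>j = 1\<close>, so the constant coefficient is 1 and
    \<open>?f\<close> is a unit.\<close>
  have "fps_nth ?f 0 \<noteq> 0" by (simp add: fps_sum_nth)
  then show ?thesis
    unfolding H_def by (simp add: fps_divide_unit inverse_mult_eq_1)
qed

text \<open>By \<open>C_add\<close>, every series in the sum of \<open>C_mult\<close> is a power of
  \<open>fps_X\<close> times \<open>C k (k * i)\<close>. This leaves a linear equation for that
  series, solved by multiplying with \<open>H (k - 1)\<close>.\<close>

lemma C_mult_H:
  assumes "k \<ge> 2"
  shows "C k (k * i) = H (k - 1) * (if i = 0 then 1 else fps_X * C k (k * i - 1))"
    (is "_ = _ * ?R")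
proof -
  let ?S = "\<Sum>j=1..k - 1. fps_X ^ j :: rat fps"
  have "(\<Sum>j<k - 1. C k (k * i + j)) = (\<Sum>j<k - 1. fps_X ^ j) * C k (k * i)"
    using C_add[OF assms] by (simp add: sum_distrib_right)
  moreover have "fps_X * (\<Sum>j<k - 1. fps_X ^ j) = ?S"
    by (simp add: sum_distrib_left sum.atLeast1_atMost_eq)
  ultimately have "fps_X * (\<Sum>j<k - 1. C k (k * i + j)) = ?S * C k (k * i)"
    by (simp only: flip: mult.assoc)
  then have "C k (k * i) = ?S * C k (k * i) + ?R"
    using C_mult[OF assms, of i] by (simp only:)
  then have "(1 - ?S) * C k (k * i) = ?R"
    by (simp add: algebra_simps)
  then have "H (k - 1) * (1 - ?S) * C k (k * i) = H (k - 1) * ?R"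
    by (simp only: mult.assoc)
  then show ?thesis by (simp only: H_unfold mult_1)
qed

theorem theorem4p2:
  fixes k d :: nat
  assumes "k \<ge> 3"
  shows "C k d = fps_X ^ d * H (k - 1) ^ (d div k + 1)"
proof (induction d)
  case 0
  then show ?case using C_mult_H[of k 0] assms by simp
next
  case (Suc d)
  show ?case
  proof (cases "Suc d mod k = 0")
    case True
    then obtain i where i: "Suc d = k * i" by auto
    then have "i \<noteq> 0" by (cases i) auto
    \<comment> \<open>Only on entering a new block does the quotient grow, which accounts for the
      additional factor \<open>H (k - 1)\<close>.\<close>
    have "Suc d div k = Suc (d div k)" using True by (simp add: div_Suc)
    moreover have "C k (Suc d) = H (k - 1) * (fps_X * C k d)"
      using C_mult_H[of k i] assms \<open>i \<noteq> 0\<close> by (simp flip: i)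
    ultimately show ?thesis by (simp add: Suc mult_ac)
  next
    case False
    then have "Suc d div k = d div k" by (simp add: div_Suc)
    then show ?thesis using C_Suc[of k d] False assms Suc by (simp add: mult.assoc)
  qed
qed

end
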